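(* Suppose that a function $f_z : \{0,1\}^m \to \{0,1\}^k$ is associated with each $z \in \{0,1\}^n$ (where $m$ and $k$ are functions of $z$), and that the classical computational complexity of the function that maps $(z,x)$ to $f_z(x)$ is bounded above by $R(n)$. Suppose also that there is a problem in the query complexity model where some property $P(f_z)$ is to be determined in terms of $f_z$-queries, and that there is a quantum circuit that solves this problem using $S(n)$ queries to $f_z$ and $T(n)$ auxiliary operations. Then the quantum computational complexity of the problem where the input is $z \in \{0,1\}^n$ and the output is the value of the property $P(f_z)$ is $O(R(n)S(n)+T(n))$.
   Context: Classical computational complexity: the number of gates of a classical circuit computing the function, where the basic gates are binary AND, binary OR and unary NOT (changing to another universal set of local gates affects this only by a multiplicative constant). Quantum circuits: circuits on qubits whose basic operations are local unitary gates (acting on a small number of qubits, say one or two), followed by a measurement of the final state in the computational basis. The quantum computational complexity of a problem is the number of gates of a quantum circuit that takes the problem instance as input and produces the required output. Query model: the problem instance is a function $f$ that is accessed only through queries. For $f : \{0,1\}^m \to \{0,1\}^k$, an $f$-query gate is the unitary transformation mapping $|x\rangle|y\rangle$ to $|x\rangle|y \oplus f(x)\rangle$ for all $x \in \{0,1\}^m$, $y \in \{0,1\}^k$, where $\oplus$ is bitwise exclusive-or. A quantum circuit in the query model has its inputs set to constant values and consists of $f$-query gates together with auxiliary operations, i.e. the non-query gates, which are ordinary local unitary gates; its output is obtained by measuring the final state. The circuit in the conclusion is obtained from the query circuit by substituting, for each $f_z$-query gate, a circuit simulating that gate.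
   Formalization: In the classical complexity, each output bit of f_z(x) must be produced by a gate of its own (no bare input wires or shared outputs), so R(n) ≥ k; otherwise the claim fails, e.g. f_z() = z with R = 0 and two queries with permuted targets. *)

theory Defs
  imports
    "HOL-Analysis.Analysis"
    "HOL-Library.Landau_Symbols"
    "HOL-Library.Extended_Nat"
    "HOL-Library.FuncSet"
begin

definition bits :: "nat \<Rightarrow> bool list set" where
  "bits n = {b. length b = n}"


subsection \<open>Classical circuits\<close>

text \<open>
  A circuit is a straight-line program. Wires \<open>0, \<dots>, N - 1\<close> carry the input; every gate reads
  earlier wires and writes the next free one.
\<close>

datatype bool_gate = AndGate nat nat | OrGate nat nat | NotGate nat

fun operands :: "bool_gate \<Rightarrow> nat set" where
  "operands (AndGate i j) = {i, j}"
| "operands (OrGate i j) = {i, j}"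
| "operands (NotGate i) = {i}"

fun gate_value :: "bool_gate \<Rightarrow> bool list \<Rightarrow> bool" where
  "gate_value (AndGate i j) ws = (ws ! i \<and> ws ! j)"
| "gate_value (OrGate i j) ws = (ws ! i \<or> ws ! j)"
| "gate_value (NotGate i) ws = (\<not> ws ! i)"

record classical_circuit =
  bool_gates :: "bool_gate list"
  output_wires :: "nat list"

definition wire_values :: "classical_circuit \<Rightarrow> bool list \<Rightarrow> bool list" where
  "wire_values C w = foldl (\<lambda>ws g. ws @ [gate_value g ws]) w (bool_gates C)"

text \<open>
  Each output bit is produced by a gate of its own, so a circuit with \<open>k\<close> outputs has at least
  \<open>k\<close> gates. Without this convention the identity function on \<open>k\<close> bits would have complexity \<open>0\<close>,
  while a query to it, \<open>|x\<rangle>|y\<rangle> \<mapsto> |x\<rangle>|y \<oplus> x\<rangle>\<close>, acts non-trivially on \<open>2 k\<close> qubits.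
\<close>

definition wf_classical_circuit :: "nat \<Rightarrow> classical_circuit \<Rightarrow> bool" where
  "wf_classical_circuit N C \<longleftrightarrow>
     (\<forall>i < length (bool_gates C). \<forall>j \<in> operands (bool_gates C ! i). j < N + i) \<and>
     distinct (output_wires C) \<and>
     set (output_wires C) \<subseteq> {N..<N + length (bool_gates C)}"

definition classical_computes :: "nat \<Rightarrow> (bool list \<Rightarrow> bool list) \<Rightarrow> classical_circuit \<Rightarrow> bool" where
  "classical_computes N F C \<longleftrightarrow>
     wf_classical_circuit N C \<and>
     (\<forall>w \<in> bits N. map ((!) (wire_values C w)) (output_wires C) = F w)"

definition classical_complexity :: "nat \<Rightarrow> (bool list \<Rightarrow> bool list) \<Rightarrow> enat" where
  "classical_complexity N F =
     (INF C \<in> {C. classical_computes N F C}. enat (length (bool_gates C)))"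


subsection \<open>Quantum states and gates\<close>

text \<open>
  A state of \<open>w\<close> qubits is given by its amplitudes in the computational basis, which consists of
  the bit lists of length \<open>w\<close>; its values at other lists play no role.
\<close>

type_synonym qstate = "bool list \<Rightarrow> complex"

definition ket :: "bool list \<Rightarrow> qstate" where
  "ket b = (\<lambda>c. if c = b then 1 else 0)"

definition adjoint_matrix :: "complex ^ 'n ^ 'n \<Rightarrow> complex ^ 'n ^ 'n" where
  "adjoint_matrix U = (\<chi> i j. cnj (U $ j $ i))"

definition unitary_matrix :: "complex ^ 'n ^ 'n \<Rightarrow> bool" where
  "unitary_matrix U \<longleftrightarrow>
     adjoint_matrix U ** U = mat 1 \<and> U ** adjoint_matrix U = mat 1"

text \<open>
  The matrix of a gate is indexed by the basis states of the one or two qubits it acts on.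
\<close>

datatype local_gate =
    Gate1 "complex ^ bool ^ bool" nat
  | Gate2 "complex ^ (bool \<times> bool) ^ (bool \<times> bool)" nat nat

fun wf_local_gate :: "nat \<Rightarrow> local_gate \<Rightarrow> bool" where
  "wf_local_gate w (Gate1 U i) \<longleftrightarrow> unitary_matrix U \<and> i < w"
| "wf_local_gate w (Gate2 U i j) \<longleftrightarrow> unitary_matrix U \<and> i < w \<and> j < w \<and> i \<noteq> j"

fun apply_local :: "local_gate \<Rightarrow> qstate \<Rightarrow> qstate" where
  "apply_local (Gate1 U i) \<psi> =
     (\<lambda>b. \<Sum>u\<in>UNIV. U $ (b ! i) $ u * \<psi> (b[i := u]))"
| "apply_local (Gate2 U i j) \<psi> =
     (\<lambda>b. \<Sum>(u, v)\<in>UNIV. U $ (b ! i, b ! j) $ (u, v) * \<psi> (b[i := u, j := v]))"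

text \<open>Born rule: the probability that measuring the qubits \<open>qs\<close> of a \<open>w\<close>-qubit state yields \<open>v\<close>.\<close>

definition outcome_prob :: "nat \<Rightarrow> nat list \<Rightarrow> qstate \<Rightarrow> bool list \<Rightarrow> real" where
  "outcome_prob w qs \<psi> v = (\<Sum>b | b \<in> bits w \<and> map ((!) b) qs = v. (cmod (\<psi> b))\<^sup>2)"

text \<open>
  The initial basis state consists of the input, if any, followed by the constants; all qubits are
  measured at the end, and the output is read off at the positions in \<open>output_qubits\<close>.
\<close>

record 'op quantum_circuit =
  constants :: "bool list"
  operations :: "'op list"
  output_qubits :: "nat list"


subsection \<open>Quantum circuits without queries\<close>

definition wf_quantum_circuit :: "nat \<Rightarrow> local_gate quantum_circuit \<Rightarrow> bool" where
  "wf_quantum_circuit n C \<longleftrightarrow>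
     (let w = n + length (constants C) in
        (\<forall>g \<in> set (operations C). wf_local_gate w g) \<and>
        distinct (output_qubits C) \<and> set (output_qubits C) \<subseteq> {..<w})"

definition output_prob :: "local_gate quantum_circuit \<Rightarrow> bool list \<Rightarrow> bool list \<Rightarrow> real" where
  "output_prob C z v =
     outcome_prob (length z + length (constants C)) (output_qubits C)
       (fold apply_local (operations C) (ket (z @ constants C))) v"

text \<open>Exact computation is the case \<open>\<epsilon> = 0\<close>.\<close>

definition quantum_computes ::
  "real \<Rightarrow> nat \<Rightarrow> (bool list \<Rightarrow> bool list) \<Rightarrow> local_gate quantum_circuit \<Rightarrow> bool" where
  "quantum_computes \<epsilon> n G C \<longleftrightarrow>
     wf_quantum_circuit n C \<and> (\<forall>z \<in> bits n. output_prob C z (G z) \<ge> 1 - \<epsilon>)"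

definition quantum_complexity :: "real \<Rightarrow> nat \<Rightarrow> (bool list \<Rightarrow> bool list) \<Rightarrow> enat" where
  "quantum_complexity \<epsilon> n G =
     (INF C \<in> {C. quantum_computes \<epsilon> n G C}. enat (length (operations C)))"


subsection \<open>Quantum circuits in the query model\<close>

text \<open>
  \<open>Query xs ys\<close> stands for a query gate whose argument register is \<open>xs\<close> and whose target register
  is \<open>ys\<close>. A circuit may be run on functions of different formats; for
  \<open>f : {0,1}\<^sup>m \<rightarrow> {0,1}\<^sup>k\<close> the gate acts on the first \<open>m\<close> qubits of \<open>xs\<close> and the first \<open>k\<close> of \<open>ys\<close>.
\<close>

datatype query_op = Aux local_gate | Query "nat list" "nat list"

fun is_query :: "query_op \<Rightarrow> bool" where
  "is_query (Query xs ys) = True"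
| "is_query (Aux g) = False"

definition query_basis ::
  "(bool list \<Rightarrow> bool list) \<Rightarrow> nat list \<Rightarrow> nat list \<Rightarrow> bool list \<Rightarrow> bool list" where
  "query_basis f xs ys b =
     fold (\<lambda>(p, v) c. c[p := (c ! p \<noteq> v)]) (zip ys (f (map ((!) b) xs))) b"

text \<open>The linear map that sends \<open>ket b\<close> to \<open>ket (query_basis f xs ys b)\<close>.\<close>

definition apply_query ::
  "(bool list \<Rightarrow> bool list) \<Rightarrow> nat list \<Rightarrow> nat list \<Rightarrow> qstate \<Rightarrow> qstate" where
  "apply_query f xs ys \<psi> =
     (\<lambda>c. \<Sum>b | b \<in> bits (length c) \<and> query_basis f xs ys b = c. \<psi> b)"

fun apply_op ::
  "nat \<Rightarrow> nat \<Rightarrow> (bool list \<Rightarrow> bool list) \<Rightarrow> query_op \<Rightarrow> qstate \<Rightarrow> qstate" where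
  "apply_op m k f (Aux g) \<psi> = apply_local g \<psi>"
| "apply_op m k f (Query xs ys) \<psi> = apply_query f (take m xs) (take k ys) \<psi>"

fun wf_op :: "nat \<Rightarrow> nat \<Rightarrow> nat \<Rightarrow> query_op \<Rightarrow> bool" where
  "wf_op M K w (Aux g) \<longleftrightarrow> wf_local_gate w g"
| "wf_op M K w (Query xs ys) \<longleftrightarrow>
     length xs = M \<and> length ys = K \<and> distinct (xs @ ys) \<and> set (xs @ ys) \<subseteq> {..<w}"

text \<open>\<open>M\<close> and \<open>K\<close> are the sizes of the argument and target registers of the query gates.\<close>

definition wf_query_circuit :: "nat \<Rightarrow> nat \<Rightarrow> query_op quantum_circuit \<Rightarrow> bool" where
  "wf_query_circuit M K C \<longleftrightarrow>
     (let w = length (constants C) in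
        (\<forall>g \<in> set (operations C). wf_op M K w g) \<and>
        distinct (output_qubits C) \<and> set (output_qubits C) \<subseteq> {..<w})"

definition query_output_prob ::
  "query_op quantum_circuit \<Rightarrow> nat \<Rightarrow> nat \<Rightarrow> (bool list \<Rightarrow> bool list) \<Rightarrow> bool list \<Rightarrow> real" where
  "query_output_prob C m k f v =
     outcome_prob (length (constants C)) (output_qubits C)
       (fold (apply_op m k f) (operations C) (ket (constants C))) v"

definition num_queries :: "query_op quantum_circuit \<Rightarrow> nat" where
  "num_queries C = length (filter is_query (operations C))"

definition num_auxiliary :: "query_op quantum_circuit \<Rightarrow> nat" where
  "num_auxiliary C = length (filter (\<lambda>g. \<not> is_query g) (operations C))"


subsection \<open>Families of functions indexed by bit strings\<close>

definition max_size :: "(bool list \<Rightarrow> nat) \<Rightarrow> nat \<Rightarrow> nat" where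
  "max_size h n = Max (h ` bits n)"

text \<open>
  The function \<open>(z, x) \<mapsto> f z x\<close> for \<open>z \<in> bits n\<close>, on the concatenation of \<open>z\<close> and \<open>x\<close>. A circuit has
  fixed numbers of inputs and outputs, so, if \<open>m\<close> and \<open>k\<close> vary on \<open>bits n\<close>, short arguments are
  followed by bits that are ignored and short values are padded with zeros. If \<open>m\<close> and \<open>k\<close> are
  constant on \<open>bits n\<close>, there is no padding.
\<close>

definition joint_function ::
  "(bool list \<Rightarrow> nat) \<Rightarrow> (bool list \<Rightarrow> nat) \<Rightarrow> (bool list \<Rightarrow> bool list \<Rightarrow> bool list) \<Rightarrow>
   nat \<Rightarrow> bool list \<Rightarrow> bool list" where
  "joint_function m k f n w =
     (let z = take n w; x = drop n w in
        f z (take (m z) x) @ replicate (max_size k n - k z) False)"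

end

theory Submission
  imports Defs
begin

text \<open>
  Every query is replaced by compute, copy, uncompute: each gate of the classical circuit for
  \<open>(z, x) \<mapsto> f_z(x)\<close> writes its value onto a fresh zero ancilla by a constant number of one- and
  two-qubit gates, the output wires are added to the target register by controlled NOTs, and the
  evaluation is undone, so the ancillas are zero again and serve the next query. The number of
  outputs is at most the number of classical gates, so a query costs \<open>O(R)\<close> gates. All these blocks
  permute the basis states, hence it suffices to follow the basis states of the form
  \<open>z, b, 0\<dots>0\<close>; since the substituted circuit is an involution, it also maps the remaining basis
  states among themselves, and amplitude zero on them is preserved.
\<close>

subsection \<open>Reversible gates\<close>

definition flip :: "nat \<Rightarrow> bool list \<Rightarrow> bool list" where
  "flip t b = b[t := \<not> b ! t]"

lemma length_flip [simp]: "length (flip t b) = length b"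
  by (simp add: flip_def)

lemma nth_flip: "t < length b \<Longrightarrow> flip t b ! i = (if i = t then \<not> b ! i else b ! i)"
  by (simp add: flip_def)

lemma flip_flip [simp]: "t < length b \<Longrightarrow> flip t (flip t b) = b"
  by (simp add: flip_def)

text \<open>The eigenvalues are \<open>1\<close> and \<open>\<alpha>\<close>, with eigenvectors \<open>|0\<rangle> + |1\<rangle>\<close> and \<open>|0\<rangle> - |1\<rangle>\<close>, so
  \<open>\<alpha> = -1\<close> gives the NOT gate and \<open>\<alpha> = \<i>\<close> a square root of it.\<close>

definition not_power :: "complex \<Rightarrow> complex ^ bool ^ bool" where
  "not_power \<alpha> = (\<chi> i j. if i = j then (1 + \<alpha>) / 2 else (1 - \<alpha>) / 2)"

text \<open>\<open>not_power 1\<close> is the identity, so the matrix is block diagonal: nothing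
  happens if the control \<open>p\<close> is 0, and \<open>not_power \<alpha>\<close> acts on
  \<open>t\<close> if it is 1.\<close>

definition controlled :: "complex \<Rightarrow> nat \<Rightarrow> nat \<Rightarrow> local_gate" where
  "controlled \<alpha> p t =
     Gate2 (\<chi> r s. if fst r = fst s then not_power (if fst r then \<alpha> else 1) $ snd r $ snd s else 0) p t"

lemma UNIV_bool_pair:
  "(UNIV :: (bool \<times> bool) set) = {(False, False), (False, True), (True, False), (True, True)}"
  by (auto simp: UNIV_bool simp flip: UNIV_Times_UNIV)

lemma unitary_not_power:
  assumes "\<alpha> * cnj \<alpha> = 1"
  shows "unitary_matrix (not_power \<alpha>)"
  using assms
  by (auto simp: unitary_matrix_def adjoint_matrix_def not_power_def matrix_matrix_mult_def mat_def
      vec_eq_iff UNIV_bool field_simps)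

lemma unitary_controlled:
  assumes "\<alpha> * cnj \<alpha> = 1"
  shows "unitary_matrix (\<chi> r s :: bool \<times> bool.
    if fst r = fst s then not_power (if fst r then \<alpha> else 1) $ snd r $ snd s else 0)"
  using assms
  by (auto simp: unitary_matrix_def adjoint_matrix_def not_power_def matrix_matrix_mult_def mat_def
      vec_eq_iff UNIV_bool_pair field_simps)

lemma wf_controlled:
  assumes "\<alpha> * cnj \<alpha> = 1"
  shows "wf_local_gate w (controlled \<alpha> p t) \<longleftrightarrow> p < w \<and> t < w \<and> p \<noteq> t"
  using assms by (simp add: controlled_def unitary_controlled)

lemma apply_not: "apply_local (Gate1 (not_power (- 1)) t) \<psi> b = \<psi> (flip t b)"
  by (cases "b ! t") (auto simp: not_power_def UNIV_bool flip_def)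

lemma apply_controlled:
  assumes "p \<noteq> t"
  shows "apply_local (controlled \<alpha> p t) \<psi> b =
    (if b ! p then ((1 + \<alpha>) * \<psi> b + (1 - \<alpha>) * \<psi> (flip t b)) / 2 else \<psi> b)"
proof -
  \<comment> \<open>After the case split on the two bits, these say that writing back the current
    bit changes nothing; they collapse the updates in the matrix sum.\<close>
  have "b[p := b ! p] = b" "b[t := b ! t] = b" by simp_all
  then show ?thesis using assms
    by (cases "b ! p"; cases "b ! t")
      (simp_all add: controlled_def not_power_def UNIV_bool_pair flip_def list_update_swap field_simps)
qed

abbreviation cnot :: "nat \<Rightarrow> nat \<Rightarrow> local_gate" where
  "cnot \<equiv> controlled (- 1)"

text \<open>For bits \<open>a, b\<close> we have \<open>\<i>^a * \<i>^b * (-\<i>)^(a XOR b) = (-1)^(a AND b)\<close>.\<close>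

definition toffoli :: "nat \<Rightarrow> nat \<Rightarrow> nat \<Rightarrow> local_gate list" where
  "toffoli p q t =
     (if p = q then [cnot p t]
      else [controlled \<i> p t, controlled \<i> q t, cnot p q, controlled (- \<i>) q t, cnot p q])"

fun gate_ops :: "bool_gate \<Rightarrow> nat \<Rightarrow> local_gate list" where
  "gate_ops (AndGate p q) t = toffoli p q t"
| "gate_ops (OrGate p q) t = cnot p t # cnot q t # toffoli p q t"
| "gate_ops (NotGate p) t = [cnot p t, Gate1 (not_power (- 1)) t]"

lemma length_gate_ops: "length (gate_ops g t) \<le> 7"
  by (cases g) (auto simp: toffoli_def)

text \<open>The amplitude of \<open>b\<close> afterwards is that of \<open>\<pi> b\<close> before,
  so on basis states the gates act as the inverse of \<open>\<pi>\<close>. This form avoids sums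
  over preimages.\<close>

definition implements :: "nat \<Rightarrow> local_gate list \<Rightarrow> (bool list \<Rightarrow> bool list) \<Rightarrow> bool" where
  "implements w gs \<pi> \<longleftrightarrow>
     (\<forall>g \<in> set gs. wf_local_gate w g) \<and> \<pi> \<in> bits w \<rightarrow> bits w \<and>
     (\<forall>\<psi>. \<forall>b \<in> bits w. fold apply_local gs \<psi> b = \<psi> (\<pi> b))"

text \<open>Permutations act on amplitudes by precomposition, so the order of composition is reversed.\<close>

lemma implements_append:
  assumes "implements w gs \<pi>" "implements w hs \<rho>"
  shows "implements w (gs @ hs) (\<pi> \<circ> \<rho>)"
  using assms by (auto simp: implements_def Pi_iff)

text \<open>\<open>foldr\<close> reflects the reversal: the first block of gates contributes the
  outermost map.\<close>

lemma implements_concat: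
  assumes "\<And>i. i \<in> set is \<Longrightarrow> implements w (gs i) (\<pi> i)"
  shows "implements w (concat (map gs is)) (foldr \<pi> is)"
  using assms
proof (induction "is")
  case Nil
  then show ?case by (simp add: implements_def)
next
  case (Cons i "is")
  then have "implements w (gs i @ concat (map gs is)) (\<pi> i \<circ> foldr \<pi> is)"
    by (intro implements_append) auto
  then show ?case by (simp add: comp_def)
qed

definition flip_if :: "(bool list \<Rightarrow> bool) \<Rightarrow> nat \<Rightarrow> bool list \<Rightarrow> bool list" where
  "flip_if c t b = (if c b then flip t b else b)"

lemma length_flip_if [simp]: "length (flip_if c t b) = length b"
  by (simp add: flip_if_def)

lemma implements_cnot:
  assumes "p < w" "t < w" "p \<noteq> t"
  shows "implements w [cnot p t] (flip_if (\<lambda>b. b ! p) t)"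
  using assms by (auto simp: implements_def bits_def wf_controlled flip_if_def apply_controlled)

lemma implements_not:
  assumes "t < w"
  shows "implements w [Gate1 (not_power (- 1)) t] (flip t)"
  using assms by (auto simp: implements_def bits_def unitary_not_power apply_not simp del: apply_local.simps)

lemma implements_toffoli:
  assumes "p < w" "q < w" "t < w" "p \<noteq> t" "q \<noteq> t"
  shows "implements w (toffoli p q t) (flip_if (\<lambda>b. b ! p \<and> b ! q) t)"
proof (cases "p = q")
  case True
  then show ?thesis using implements_cnot[of p w t] assms by (simp add: toffoli_def)
next
  case False
  \<comment> \<open>If \<open>p\<close> is set, the two \<open>cnot p q\<close> conjugate the
    inverse square root gate; their flips of \<open>q\<close> commute with the flip of
    \<open>t\<close> and cancel.\<close>
  have swap: "flip q (flip t (flip q b)) = flip t b" if "length b = w" for b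
    using that assms by (simp add: flip_def list_update_swap)
  show ?thesis using assms False swap
    by (auto simp: implements_def toffoli_def bits_def wf_controlled flip_if_def apply_controlled
        nth_flip field_simps)
qed

lemma implements_gate_ops:
  assumes "\<forall>p \<in> operands g. p < w \<and> p \<noteq> t" "t < w"
  shows "implements w (gate_ops g t) (flip_if (gate_value g) t)"
proof (cases g)
  case (AndGate p q)
  then show ?thesis using implements_toffoli[of p w q t] assms
    by (simp add: flip_if_def[abs_def])
next
  case (OrGate p q)
  \<comment> \<open>Disjunction as a sum modulo 2: \<open>a OR b = a XOR b XOR (a AND b)\<close>,
    which also holds when both operands are the same wire.\<close>
  then have *: "implements w ([cnot p t] @ [cnot q t] @ toffoli p q t)
     (flip_if (\<lambda>b. b ! p) t \<circ> (flip_if (\<lambda>b. b ! q) t \<circ> flip_if (\<lambda>b. b ! p \<and> b ! q) t))"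
    using assms by (intro implements_append implements_cnot implements_toffoli) auto
  have "(flip_if (\<lambda>b. b ! p) t \<circ> (flip_if (\<lambda>b. b ! q) t \<circ> flip_if (\<lambda>b. b ! p \<and> b ! q) t)) b =
     flip_if (gate_value g) t b" if "b \<in> bits w" for b
    using OrGate assms that by (auto simp: flip_if_def nth_flip bits_def)
  with * show ?thesis using OrGate by (auto simp: implements_def bits_def)
next
  case (NotGate p)
  then have *: "implements w ([cnot p t] @ [Gate1 (not_power (- 1)) t])
     (flip_if (\<lambda>b. b ! p) t \<circ> flip t)"
    using assms by (intro implements_append implements_cnot implements_not) auto
  have "(flip_if (\<lambda>b. b ! p) t \<circ> flip t) b = flip_if (gate_value g) t b" if "b \<in> bits w" for b
    using NotGate assms that by (auto simp: flip_if_def nth_flip bits_def)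
  with * show ?thesis using NotGate by (auto simp: implements_def bits_def)
qed

text \<open>The gate does not read its target, so the flip leaves the condition intact.\<close>

lemma flip_if_flip_if:
  assumes "t \<notin> operands g" "t < length b"
  shows "flip_if (gate_value g) t (flip_if (gate_value g) t b) = b"
  using assms by (cases g) (auto simp: flip_if_def nth_flip)

subsection \<open>Queries\<close>

text \<open>The update inside \<open>query_basis\<close> with the value decoupled from the state, so
  that an induction can vary the state while the value stays fixed.\<close>

definition xor_into :: "nat list \<Rightarrow> bool list \<Rightarrow> bool list \<Rightarrow> bool list" where
  "xor_into ys vs b = fold (\<lambda>(p, v) c. c[p := (c ! p \<noteq> v)]) (zip ys vs) b"

lemma xor_into_Nil [simp]: "xor_into [] vs b = b" "xor_into ys [] b = b"
  by (simp_all add: xor_into_def)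

lemma xor_into_Cons [simp]:
  "xor_into (y # ys) (v # vs) b = xor_into ys vs (b[y := (b ! y \<noteq> v)])"
  by (simp add: xor_into_def)

lemma length_xor_into [simp]: "length (xor_into ys vs b) = length b"
  by (induction ys vs arbitrary: b rule: list_induct2') simp_all

lemma nth_xor_into: "p \<notin> set ys \<Longrightarrow> xor_into ys vs b ! p = b ! p"
  by (induction ys vs arbitrary: b rule: list_induct2') simp_all

lemma xor_into_update:
  "p \<notin> set ys \<Longrightarrow> xor_into ys vs (b[p := u]) = (xor_into ys vs b)[p := u]"
proof (induction ys vs arbitrary: b rule: list_induct2')
  case (4 y ys v vs)
  then have "b[p := u, y := (b ! y \<noteq> v)] = b[y := (b ! y \<noteq> v), p := u]"
    by (intro list_update_swap) auto
  with 4 show ?case by simp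
qed simp_all

text \<open>As \<open>ys\<close> has no repetitions, the head update commutes past the others and
  each position receives its bit twice.\<close>

lemma xor_into_xor_into:
  "distinct ys \<Longrightarrow> set ys \<subseteq> {..<length b} \<Longrightarrow> xor_into ys vs (xor_into ys vs b) = b"
proof (induction ys vs arbitrary: b rule: list_induct2')
  case (4 y ys v vs)
  then have "xor_into ys vs (xor_into ys vs b) = b" by simp
  moreover have "b[y := ((b ! y \<noteq> v) \<noteq> v)] = b"
    by (cases v) simp_all
  ultimately show ?case using 4 by (simp add: xor_into_update nth_xor_into)
qed simp_all

lemma xor_into_append:
  "set ys \<subseteq> {..<length b} \<Longrightarrow>
   xor_into (map ((+) (length a)) ys) vs (a @ b @ c) = a @ xor_into ys vs b @ c"
proof (induction ys vs arbitrary: b rule: list_induct2')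
  case (4 y ys v vs)
  from 4(1)[of "b[y := (b ! y \<noteq> v)]"] 4(2) show ?case
    by (simp add: nth_append list_update_append)
qed simp_all

lemma xor_into_replicate_False [simp]: "xor_into ys (replicate l False) b = b"
proof (induction l arbitrary: ys)
  case (Suc l)
  then show ?case by (cases ys) simp_all
qed simp

text \<open>Adding zeros has no effect, so padding a value amounts to shortening the target
  register.\<close>

lemma xor_into_append_replicate_False:
  "xor_into ys (vs @ replicate l False) b = xor_into (take (length vs) ys) vs b"
  by (induction ys vs arbitrary: b rule: list_induct2') simp_all

lemma query_basis_eq: "query_basis f xs ys b = xor_into ys (f (map ((!) b) xs)) b"
  by (simp add: query_basis_def xor_into_def)

lemma length_query_basis [simp]: "length (query_basis f xs ys b) = length b"
  by (simp add: query_basis_eq)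

text \<open>The argument register is disjoint from the target, so the second application reads the
  same argument and adds the same value.\<close>

lemma query_basis_query_basis:
  assumes "distinct (xs @ ys)" "set ys \<subseteq> {..<length b}"
  shows "query_basis f xs ys (query_basis f xs ys b) = b"
proof -
  have "map ((!) (xor_into ys vs b)) xs = map ((!) b) xs" for vs
    using assms nth_xor_into[of _ ys vs b] by (simp add: disjoint_iff)
  note this[of "f (map ((!) b) xs)"]
  then show ?thesis using assms xor_into_xor_into[of ys b "f (map ((!) b) xs)"]
    unfolding query_basis_eq by (metis distinct_append)
qed

text \<open>The involution makes the preimage of \<open>c\<close> a singleton, which turns the sum
  into the precomposition used in \<open>implements\<close>.\<close>

lemma apply_query_eq:
  assumes "distinct (xs @ ys)" "set ys \<subseteq> {..<length c}"
  shows "apply_query f xs ys \<psi> c = \<psi> (query_basis f xs ys c)"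
proof -
  have "{b. b \<in> bits (length c) \<and> query_basis f xs ys b = c} = {query_basis f xs ys c}"
  proof (intro equalityI subsetI)
    fix b assume "b \<in> {b. b \<in> bits (length c) \<and> query_basis f xs ys b = c}"
    then show "b \<in> {query_basis f xs ys c}"
      using assms query_basis_query_basis[of xs ys b f] by (simp add: bits_def)
  next
    fix b assume "b \<in> {query_basis f xs ys c}"
    then show "b \<in> {b. b \<in> bits (length c) \<and> query_basis f xs ys b = c}"
      using query_basis_query_basis[OF assms, of f] by (simp add: bits_def)
  qed
  then show ?thesis by (simp add: apply_query_def)
qed

text \<open>The reversal turns the \<open>foldr\<close> from \<open>implements_concat\<close> into a
  \<open>fold\<close> along \<open>zip ps ys\<close>, the order in which \<open>query_basis\<close>
  works.\<close>

definition copy_ops :: "nat list \<Rightarrow> nat list \<Rightarrow> local_gate list" where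
  "copy_ops ps ys = concat (map (\<lambda>(p, y). [cnot p y]) (rev (zip ps ys)))"

lemma fold_flip_if_eq_query_basis:
  "distinct (ps @ ys) \<Longrightarrow>
   fold (\<lambda>(p, y). flip_if (\<lambda>b. b ! p) y) (zip ps ys) b = query_basis (\<lambda>x. x) ps ys b"
proof (induction ps ys arbitrary: b rule: list_induct2')
  case (4 p ps y ys)
  define c where "c = flip_if (\<lambda>b. b ! p) y b"
  have c: "c = b[y := (b ! y \<noteq> b ! p)]"
    by (auto simp: c_def flip_if_def flip_def)
  \<comment> \<open>Targets are never sources, so the later controlled NOTs still read the original
    bits.\<close>
  have "y \<noteq> x" if "x \<in> set ps" for x
    using 4(2) that by auto
  then have "map ((!) c) ps = map ((!) b) ps"
    by (simp add: c)
  note c this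
  moreover have "fold (\<lambda>(p, y). flip_if (\<lambda>b. b ! p) y) (zip (p # ps) (y # ys)) b =
      xor_into ys (map ((!) c) ps) c"
    using 4(1)[of c] 4(2) by (simp add: query_basis_eq c_def)
  ultimately show ?case by (simp only: query_basis_eq list.map xor_into_Cons)
qed (simp_all add: query_basis_eq)

lemma implements_copy_ops:
  assumes "distinct (ps @ ys)" "set (ps @ ys) \<subseteq> {..<w}"
  shows "implements w (copy_ops ps ys) (query_basis (\<lambda>x. x) ps ys)"
proof -
  have "implements w (copy_ops ps ys) (foldr (\<lambda>(p, y). flip_if (\<lambda>b. b ! p) y) (rev (zip ps ys)))"
    unfolding copy_ops_def
    using assms by (intro implements_concat)
      (auto dest: set_zip_leftD set_zip_rightD intro!: implements_cnot)
  then show ?thesis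
    using fold_flip_if_eq_query_basis[OF assms(1)] unfolding foldr_conv_fold rev_rev_ident
    by (metis ext)
qed

subsection \<open>Evaluating a classical circuit on ancillas\<close>

fun relabel :: "(nat \<Rightarrow> nat) \<Rightarrow> bool_gate \<Rightarrow> bool_gate" where
  "relabel \<sigma> (AndGate i j) = AndGate (\<sigma> i) (\<sigma> j)"
| "relabel \<sigma> (OrGate i j) = OrGate (\<sigma> i) (\<sigma> j)"
| "relabel \<sigma> (NotGate i) = NotGate (\<sigma> i)"

lemma operands_relabel [simp]: "operands (relabel \<sigma> g) = \<sigma> ` operands g"
  by (cases g) auto

lemma gate_value_relabel:
  "(\<And>p. p \<in> operands g \<Longrightarrow> b ! \<sigma> p = ws ! p) \<Longrightarrow>
   gate_value (relabel \<sigma> g) b = gate_value g ws"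
  by (cases g) auto

text \<open>Gate \<open>i\<close> owns the ancilla \<open>a + i\<close>. Flipping it by the value,
  rather than overwriting it, keeps the step reversible and stores the value if the ancilla was
  zero.\<close>

definition eval_step :: "(nat \<Rightarrow> nat) \<Rightarrow> nat \<Rightarrow> bool_gate list \<Rightarrow> nat \<Rightarrow> bool list \<Rightarrow> bool list" where
  "eval_step \<sigma> a gs i = flip_if (gate_value (relabel \<sigma> (gs ! i))) (a + i)"

text \<open>The explicit index list lets the same gates run forwards to compute and backwards to
  uncompute.\<close>

definition eval_ops :: "(nat \<Rightarrow> nat) \<Rightarrow> nat \<Rightarrow> bool_gate list \<Rightarrow> nat list \<Rightarrow> local_gate list" where
  "eval_ops \<sigma> a gs is = concat (map (\<lambda>i. gate_ops (relabel \<sigma> (gs ! i)) (a + i)) is)"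

lemma length_eval_step [simp]: "length (eval_step \<sigma> a gs i b) = length b"
  by (simp add: eval_step_def)

lemma length_fold_eval_step [simp]: "length (fold (eval_step \<sigma> a gs) is b) = length b"
  by (induction "is" arbitrary: b) simp_all

lemma length_foldr_eval_step [simp]: "length (foldr (eval_step \<sigma> a gs) is b) = length b"
  by (induction "is" arbitrary: b) simp_all

lemma length_eval_ops: "length (eval_ops \<sigma> a gs is) \<le> 7 * length is"
proof (induction "is")
  case (Cons i "is")
  then show ?case using length_gate_ops[of "relabel \<sigma> (gs ! i)" "a + i"]
    by (simp add: eval_ops_def)
qed (simp add: eval_ops_def)

text \<open>The step done last is undone first. The length is carried along because the steps are
  involutions only on lists of that length.\<close>

lemma foldr_fold_involutions:
  assumes "\<And>i c. i \<in> set is \<Longrightarrow> length c = n \<Longrightarrow> length (s i c) = n \<and> s i (s i c) = c"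
    and "length b = n"
  shows "foldr s is (fold s is b) = b"
  using assms
proof (induction "is" arbitrary: b)
  case (Cons i "is")
  from Cons.prems have "foldr s is (fold s is (s i b)) = s i b"
    by (intro Cons.IH) auto
  with Cons.prems show ?case by simp
qed simp

abbreviation run :: "bool_gate list \<Rightarrow> bool list \<Rightarrow> bool list" where
  "run gs ws \<equiv> foldl (\<lambda>ws g. ws @ [gate_value g ws]) ws gs"

lemma length_run [simp]: "length (run gs ws) = length ws + length gs"
  by (induction gs arbitrary: ws) simp_all

lemma take_run: "take (length ws) (run gs ws) = ws"
  by (induction gs rule: rev_induct) simp_all

lemma nth_run: "p < length ws \<Longrightarrow> run gs ws ! p = ws ! p"
  using nth_take[of p "length ws" "run gs ws"] by (simp add: take_run)

text \<open>Loop invariant over \<open>j\<close>. The operands of the next gate are inputs, found in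
  \<open>d\<close>, or earlier wires, found on ancillas already written.\<close>

lemma fold_eval_step:
  assumes inputs: "\<And>p. p < length ws \<Longrightarrow> \<sigma> p < length d \<and> d ! \<sigma> p = ws ! p"
    and ancillas: "\<And>i. \<sigma> (length ws + i) = length d + i"
    and wf: "\<And>i p. i < length gs \<Longrightarrow> p \<in> operands (gs ! i) \<Longrightarrow> p < length ws + i"
    and "j \<le> length gs"
  shows "fold (eval_step \<sigma> (length d) gs) [0..<j] (d @ replicate (length gs) False) =
     d @ drop (length ws) (run (take j gs) ws) @ replicate (length gs - j) False"
  using \<open>j \<le> length gs\<close>
proof (induction j)
  case (Suc j)
  define W where "W = run (take j gs) ws"
  define c where "c = d @ drop (length ws) W @ replicate (length gs - j) False"
  have j: "j < length gs" and W: "length W = length ws + j"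
    using Suc.prems by (simp_all add: W_def)
  have *: "c ! \<sigma> p = W ! p" if "p < length ws + j" for p
  proof (cases "p < length ws")
    case True
    then show ?thesis using inputs[of p] by (simp add: c_def W_def nth_append nth_run)
  next
    case False
    then obtain i where i: "p = length ws + i" by (metis le_add_diff_inverse not_less)
    then show ?thesis using that W ancillas[of i] by (simp add: c_def nth_append)
  qed
  have "eval_step \<sigma> (length d) gs j c = c[length d + j := gate_value (gs ! j) W]"
  proof -
    have "gate_value (relabel \<sigma> (gs ! j)) c = gate_value (gs ! j) W"
      by (rule gate_value_relabel) (use * wf[OF j] in simp)
    \<comment> \<open>Ancilla \<open>j\<close> is still zero, so the conditional flip writes exactly
      the value of the gate.\<close>
    moreover have "\<not> c ! (length d + j)"
      using W j by (simp add: c_def nth_append)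
    moreover from this have "c[length d + j := False] = c"
      using list_update_id[of c "length d + j"] by simp
    ultimately show ?thesis
      by (cases "gate_value (gs ! j) W") (auto simp: eval_step_def flip_if_def flip_def)
  qed
  also have "\<dots> = d @ drop (length ws) W @ gate_value (gs ! j) W # replicate (length gs - Suc j) False"
  proof -
    have "length gs - j = Suc (length gs - Suc j)" using j by simp
    then show ?thesis using W by (simp add: c_def list_update_append)
  qed
  also have "\<dots> = d @ drop (length ws) (run (take (Suc j) gs) ws) @ replicate (length gs - Suc j) False"
    using j W by (simp add: take_Suc_conv_app_nth flip: W_def)
  finally show ?case using Suc.IH j by (simp add: c_def W_def)
qed simp

text \<open>
  The layout is: \<open>n\<close> input qubits, then the \<open>w\<close> qubits of the query circuit, then one ancilla per
  classical gate. The wires of the classical circuit are placed accordingly.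
\<close>

definition wire_qubit :: "nat \<Rightarrow> nat \<Rightarrow> nat list \<Rightarrow> nat \<Rightarrow> nat" where
  "wire_qubit n w xs p =
     (if p < n then p else if p < n + length xs then n + xs ! (p - n)
      else n + w + (p - (n + length xs)))"

definition query_ops :: "nat \<Rightarrow> nat \<Rightarrow> classical_circuit \<Rightarrow> nat list \<Rightarrow> nat list \<Rightarrow> local_gate list" where
  "query_ops n w C xs ys =
     (let \<sigma> = wire_qubit n w xs; gs = bool_gates C; is = [0..<length gs]
      in eval_ops \<sigma> (n + w) gs is @
         copy_ops (map \<sigma> (output_wires C)) (map ((+) n) ys) @
         eval_ops \<sigma> (n + w) gs (rev is))"

text \<open>Precomposition reverses the blocks: the inner \<open>fold\<close> belongs to the last
  block of gates and the outer \<open>foldr\<close> to the first. The symmetry of compute, copy,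
  uncompute makes this again a simulated query.\<close>

definition query_perm :: "nat \<Rightarrow> nat \<Rightarrow> classical_circuit \<Rightarrow> nat list \<Rightarrow> nat list \<Rightarrow> bool list \<Rightarrow> bool list" where
  "query_perm n w C xs ys =
     (let \<sigma> = wire_qubit n w xs; gs = bool_gates C; is = [0..<length gs]
      in foldr (eval_step \<sigma> (n + w) gs) is \<circ>
         (query_basis (\<lambda>x. x) (map \<sigma> (output_wires C)) (map ((+) n) ys) \<circ>
          fold (eval_step \<sigma> (n + w) gs) is))"

section \<open>Correctness of the circuit substituted for a query\<close>

context
  fixes n w :: nat and C :: classical_circuit and xs ys :: "nat list"
  assumes wf: "wf_classical_circuit (n + length xs) C"
    and regs: "distinct (xs @ ys)" "set (xs @ ys) \<subseteq> {..<w}"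
begin

private abbreviation "\<sigma> \<equiv> wire_qubit n w xs"
private abbreviation "gs \<equiv> bool_gates C"
private abbreviation "W \<equiv> n + w + length gs"

text \<open>Inputs and query qubits precede all ancillas, and earlier wires use earlier ancillas; so
  no gate reads the ancilla it writes.\<close>

lemma wire_qubit_operand:
  assumes "i < length gs" "p \<in> operands (gs ! i)"
  shows "\<sigma> p < n + w + i"
proof -
  have "p < n + length xs + i" using wf assms by (auto simp: wf_classical_circuit_def)
  moreover have "xs ! (p - n) < w" if "\<not> p < n" "p < n + length xs"
  proof -
    have "xs ! (p - n) \<in> set xs" using that by (intro nth_mem) linarith
    then show ?thesis using regs(2) by auto
  qed
  ultimately show ?thesis by (auto simp: wire_qubit_def)
qed

lemma implements_eval_ops:
  assumes "set is \<subseteq> {..<length gs}"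
  shows "implements W (eval_ops \<sigma> (n + w) gs is) (foldr (eval_step \<sigma> (n + w) gs) is)"
  unfolding eval_ops_def
proof (intro implements_concat)
  fix i assume "i \<in> set is"
  then have "i < length gs" using assms by auto
  with wire_qubit_operand[OF this]
  show "implements W (gate_ops (relabel \<sigma> (gs ! i)) (n + w + i)) (eval_step \<sigma> (n + w) gs i)"
    unfolding eval_step_def by (intro implements_gate_ops) fastforce+
qed

lemma eval_step_eval_step:
  assumes "i < length gs" "length b = W"
  shows "eval_step \<sigma> (n + w) gs i (eval_step \<sigma> (n + w) gs i b) = b"
  unfolding eval_step_def using assms wire_qubit_operand[OF assms(1)]
  by (intro flip_if_flip_if) fastforce+

lemma foldr_fold_eval_step:
  "length b = W \<Longrightarrow>
   foldr (eval_step \<sigma> (n + w) gs) [0..<length gs] (fold (eval_step \<sigma> (n + w) gs) [0..<length gs] b) = b"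
  by (rule foldr_fold_involutions[where n = W]) (auto simp: eval_step_eval_step)

text \<open>The same cancellation along the reversed index list, where the two folds trade
  places.\<close>

lemma fold_foldr_eval_step:
  "length b = W \<Longrightarrow>
   fold (eval_step \<sigma> (n + w) gs) [0..<length gs] (foldr (eval_step \<sigma> (n + w) gs) [0..<length gs] b) = b"
  using foldr_fold_involutions[of "rev [0..<length gs]" W "eval_step \<sigma> (n + w) gs" b]
  by (simp add: eval_step_eval_step foldr_conv_fold)

text \<open>Output wires are produced by gates, so they sit on ancillas, away from the target
  register, and \<open>wire_qubit\<close> is injective there.\<close>

lemma distinct_copy_registers:
  "distinct (map \<sigma> (output_wires C) @ map ((+) n) ys)"
  "set (map \<sigma> (output_wires C) @ map ((+) n) ys) \<subseteq> {..<W}"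
proof -
  have *: "\<sigma> p = n + w + (p - (n + length xs))" "p - (n + length xs) < length gs"
      "n + length xs \<le> p" if "p \<in> set (output_wires C)" for p
  proof -
    have p: "n + length xs \<le> p" "p < n + length xs + length gs"
      using that wf by (auto simp: wf_classical_circuit_def)
    then show "\<sigma> p = n + w + (p - (n + length xs))" "n + length xs \<le> p"
      by (simp_all add: wire_qubit_def)
    from p show "p - (n + length xs) < length gs" by linarith
  qed
  have "inj_on \<sigma> (set (output_wires C))"
  proof (rule inj_onI)
    fix p q assume "p \<in> set (output_wires C)" "q \<in> set (output_wires C)" "\<sigma> p = \<sigma> q"
    with *(1,3)[of p] *(1,3)[of q] show "p = q" by simp
  qed
  moreover have "\<sigma> p \<noteq> n + y" if "p \<in> set (output_wires C)" "y \<in> set ys" for p y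
  proof -
    have "y < w" using regs(2) that(2) by auto
    with *(1)[OF that(1)] show ?thesis by simp
  qed
  ultimately show "distinct (map \<sigma> (output_wires C) @ map ((+) n) ys)"
    using wf regs(1) by (auto simp: wf_classical_circuit_def distinct_map)
  have "\<sigma> p < W" if "p \<in> set (output_wires C)" for p
    using *(1,2)[OF that] by linarith
  then show "set (map \<sigma> (output_wires C) @ map ((+) n) ys) \<subseteq> {..<W}"
    using regs(2) by auto
qed

lemma implements_query_ops: "implements W (query_ops n w C xs ys) (query_perm n w C xs ys)"
proof -
  have "fold (eval_step \<sigma> (n + w) gs) [0..<length gs] =
      foldr (eval_step \<sigma> (n + w) gs) (rev [0..<length gs])"
    by (simp add: foldr_conv_fold)
  then show ?thesis
    unfolding query_ops_def query_perm_def Let_def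
    by (simp only:) (intro implements_append implements_eval_ops implements_copy_ops
        distinct_copy_registers, auto)
qed

text \<open>A conjugate of the involution \<open>query_basis\<close> by the evaluation, which
  \<open>foldr\<close> inverts.\<close>

lemma query_perm_query_perm:
  assumes "length b = W"
  shows "query_perm n w C xs ys (query_perm n w C xs ys b) = b"
proof -
  have "set (map ((+) n) ys) \<subseteq> {..<W}" using distinct_copy_registers(2) by simp
  then show ?thesis
    using assms distinct_copy_registers(1)
    by (simp add: query_perm_def Let_def fold_foldr_eval_step foldr_fold_eval_step
        query_basis_query_basis del: distinct_append)
qed

text \<open>The target qubits are not read by the classical circuit, so uncomputing after the copy is
  the same as uncomputing the evaluation on the modified basis state.\<close>

lemma query_perm_clean:
  assumes computes: "classical_computes (n + length xs) F C"
    and len: "length z = n" "length mid = w"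
  shows "query_perm n w C xs ys (z @ mid @ replicate (length gs) False) =
    z @ query_basis (\<lambda>x. F (z @ x)) xs ys mid @ replicate (length gs) False"
proof -
  let ?E = "fold (eval_step \<sigma> (n + w) gs) [0..<length gs]"
  define x where "x = map ((!) mid) xs"
  define vals where "vals = drop (n + length xs) (run gs (z @ x))"
  \<comment> \<open>Stated for every \<open>b\<close> with argument \<open>x\<close>, as it serves
    both \<open>mid\<close> and the register \<open>q\<close> after the query.\<close>
  have E: "?E (z @ b @ replicate (length gs) False) = z @ b @ vals"
    if "length b = w" "map ((!) b) xs = x" for b
  proof -
    have "xs ! i < w" if "i < length xs" for i
      using regs(2) nth_mem[OF that] by auto
    moreover have "b ! (xs ! i) = x ! i" if "i < length xs" for i
      using that \<open>map ((!) b) xs = x\<close> by (metis nth_map)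
    moreover have "\<And>i p. i < length gs \<Longrightarrow> p \<in> operands (gs ! i) \<Longrightarrow> p < n + length xs + i"
      using wf by (auto simp: wf_classical_circuit_def)
    ultimately show ?thesis
      using fold_eval_step[of "z @ x" \<sigma> "z @ b" gs "length gs"] len that(1)
      by (simp add: wire_qubit_def nth_append vals_def x_def)
  qed
  define q where "q = query_basis (\<lambda>x. F (z @ x)) xs ys mid"
  have q: "q = xor_into ys (F (z @ x)) mid" "length q = w"
    using len by (simp_all add: q_def query_basis_eq x_def)
  then have "map ((!) q) xs = x"
    using regs(1) nth_xor_into[of _ ys "F (z @ x)" mid] by (simp add: x_def disjoint_iff)
  have "(z @ mid @ vals) ! \<sigma> p = run gs (z @ x) ! p" if "p \<in> set (output_wires C)" for p
  proof -
    have p: "n + length xs \<le> p" "p < n + length xs + length gs"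
      using that wf by (auto simp: wf_classical_circuit_def)
    then obtain i where "p = n + length xs + i" by (metis le_add_diff_inverse)
    with p show ?thesis using len by (simp add: wire_qubit_def nth_append vals_def x_def)
  qed
  then have "map ((!) (z @ mid @ vals)) (map \<sigma> (output_wires C)) =
      map ((!) (wire_values C (z @ x))) (output_wires C)"
    unfolding wire_values_def map_map comp_def by (intro map_cong refl)
  also have "\<dots> = F (z @ x)"
    using computes len by (simp add: classical_computes_def bits_def x_def)
  finally have "query_basis (\<lambda>x. x) (map \<sigma> (output_wires C)) (map ((+) n) ys) (z @ mid @ vals) =
      z @ q @ vals"
    using regs(2) len xor_into_append[of ys mid z "F (z @ x)" vals]
    by (simp add: query_basis_eq q del: map_map)
  also have "\<dots> = ?E (z @ q @ replicate (length gs) False)"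
    using E[of q] q \<open>map ((!) q) xs = x\<close> by simp
  finally show ?thesis
    using E[of mid] len q
    by (simp add: query_perm_def Let_def foldr_fold_eval_step x_def flip: q_def)
qed

end

text \<open>Two evaluations with at most 7 gates per classical gate, and at most one controlled NOT
  per output wire: \<open>7 + 1 + 7 = 15\<close>.\<close>

lemma length_query_ops:
  assumes "length (output_wires C) \<le> length (bool_gates C)"
  shows "length (query_ops n w C xs ys) \<le> 15 * length (bool_gates C)"
proof -
  have "length (copy_ops ps zs) \<le> length ps" for ps zs
  proof -
    have "length (concat (map (\<lambda>(p, y). [cnot p y]) xs)) = length xs" for xs
      by (induction xs) auto
    then show ?thesis by (simp add: copy_ops_def)
  qed
  from this[of "map (wire_qubit n w xs) (output_wires C)" "map ((+) n) ys"] show ?thesis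
    using assms length_eval_ops[of "wire_qubit n w xs" "n + w" "bool_gates C" "[0..<length (bool_gates C)]"]
      length_eval_ops[of "wire_qubit n w xs" "n + w" "bool_gates C" "rev [0..<length (bool_gates C)]"]
    by (simp add: query_ops_def Let_def)
qed

subsection \<open>Simulating the query circuit\<close>

fun shift_gate :: "nat \<Rightarrow> local_gate \<Rightarrow> local_gate" where
  "shift_gate n (Gate1 U i) = Gate1 U (n + i)"
| "shift_gate n (Gate2 U i j) = Gate2 U (n + i) (n + j)"

lemma wf_shift_gate: "wf_local_gate w g \<Longrightarrow> n + w \<le> w' \<Longrightarrow> wf_local_gate w' (shift_gate n g)"
  by (cases g) auto

fun simulate_op :: "nat \<Rightarrow> nat \<Rightarrow> classical_circuit \<Rightarrow> query_op \<Rightarrow> local_gate list" where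
  "simulate_op n w C (Aux g) = [shift_gate n g]"
| "simulate_op n w C (Query xs ys) = query_ops n w C xs ys"

text \<open>The state \<open>\<phi>\<close> is \<open>|z\<rangle> \<otimes> \<psi> \<otimes> |0\<dots>0\<rangle>\<close>.\<close>

definition simulates :: "bool list \<Rightarrow> nat \<Rightarrow> nat \<Rightarrow> qstate \<Rightarrow> qstate \<Rightarrow> bool" where
  "simulates z w r \<phi> \<psi> \<longleftrightarrow>
     (\<forall>z' mid anc. length z' = length z \<and> length mid = w \<and> length anc = r \<longrightarrow>
        \<phi> (z' @ mid @ anc) = (if z' = z \<and> anc = replicate r False then \<psi> mid else 0))"

lemma simulatesD:
  "simulates z w r \<phi> \<psi> \<Longrightarrow> length z' = length z \<Longrightarrow> length mid = w \<Longrightarrow> length anc = r \<Longrightarrow>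
   \<phi> (z' @ mid @ anc) = (if z' = z \<and> anc = replicate r False then \<psi> mid else 0)"
  by (simp add: simulates_def)

lemma simulates_ket:
  "length c = w \<Longrightarrow> simulates z w r (ket (z @ c @ replicate r False)) (ket c)"
  by (auto simp: simulates_def ket_def)

lemma simulates_shift_gate:
  assumes "simulates z w r \<phi> \<psi>" "wf_local_gate w g"
  shows "simulates z w r (apply_local (shift_gate (length z) g) \<phi>) (apply_local g \<psi>)"
  unfolding simulates_def
proof (intro allI impI, elim conjE)
  fix z' mid anc :: "bool list"
  assume len: "length z' = length z" "length mid = w" "length anc = r"
  have nth: "(z' @ c @ anc) ! (length z + i) = c ! i"
    and upd: "(z' @ c @ anc)[length z + i := u] = z' @ c[i := u] @ anc"
    if "i < length c" for c i u
    using that len(1) by (simp_all add: nth_append list_update_append)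
  \<comment> \<open>The gate changes neither \<open>z'\<close> nor \<open>anc\<close>, so all
    amplitudes in its matrix sum fall into the same case.\<close>
  define clean where "clean \<longleftrightarrow> z' = z \<and> anc = replicate r False"
  have "\<phi> (z' @ c @ anc) = (if clean then \<psi> c else 0)" if "length c = w" for c
    using simulatesD[OF assms(1) len(1) that len(3)] by (simp add: clean_def)
  then have "apply_local (shift_gate (length z) g) \<phi> (z' @ mid @ anc) =
    (if clean then apply_local g \<psi> mid else 0)"
    using assms(2) len(2)
    by (cases g; cases clean) (simp_all add: nth upd case_prod_unfold)
  then show "apply_local (shift_gate (length z) g) \<phi> (z' @ mid @ anc) =
    (if z' = z \<and> anc = replicate r False then apply_local g \<psi> mid else 0)"
    by (simp add: clean_def)
qed

lemma simulates_query_ops: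
  assumes sim: "simulates z w r \<phi> \<psi>" and r: "r = length (bool_gates C)"
    and computes: "classical_computes (length z + length xs) F C"
    and regs: "distinct (xs @ ys)" "set (xs @ ys) \<subseteq> {..<w}"
  shows "simulates z w r (fold apply_local (query_ops (length z) w C xs ys) \<phi>)
    (apply_query (\<lambda>x. F (z @ x)) xs ys \<psi>)"
  unfolding simulates_def
proof (intro allI impI, elim conjE)
  fix z' mid anc :: "bool list"
  assume len: "length z' = length z" "length mid = w" "length anc = r"
  let ?\<pi> = "query_perm (length z) w C xs ys"
  let ?q = "query_basis (\<lambda>x. F (z @ x)) xs ys"
  define b where "b = z' @ mid @ anc"
  have wf: "wf_classical_circuit (length z + length xs) C"
    using computes by (simp add: classical_computes_def)
  have b: "length b = length z + w + r" using len by (simp add: b_def)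
  note clean = query_perm_clean[OF wf regs computes refl, folded r]
  have impl: "implements (length z + w + r) (query_ops (length z) w C xs ys) ?\<pi>"
    using implements_query_ops[OF wf regs] r by simp
  then have "fold apply_local (query_ops (length z) w C xs ys) \<phi> b = \<phi> (?\<pi> b)"
    using b by (simp add: implements_def bits_def)
  also have "\<dots> = (if z' = z \<and> anc = replicate r False then \<psi> (?q mid) else 0)"
  proof (cases "z' = z \<and> anc = replicate r False")
    case True
    then have "?\<pi> b = z @ ?q mid @ replicate r False"
      using clean len by (simp add: b_def)
    then show ?thesis using True sim len by (simp add: simulatesD)
  next
    case False
    have "length (?\<pi> b) = length z + w + r"
      using impl b by (auto simp: implements_def bits_def Pi_iff)
    then obtain z'' mid'' anc'' where *: "?\<pi> b = z'' @ mid'' @ anc''"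
      "length z'' = length z" "length mid'' = w" "length anc'' = r"
      by (metis (no_types, lifting) append_eq_conv_conj length_append add.assoc length_drop
          length_take add_diff_cancel_left' append_take_drop_id min.absorb2 le_add1)
    \<comment> \<open>The permutation keeps clean states clean; being an involution, it would send a
      clean image of \<open>b\<close> back to a clean \<open>b\<close>.\<close>
    have "\<not> (z'' = z \<and> anc'' = replicate r False)"
    proof
      assume "z'' = z \<and> anc'' = replicate r False"
      then have "?\<pi> (?\<pi> b) = z @ ?q mid'' @ replicate r False"
        using clean * by simp
      moreover have "?\<pi> (?\<pi> b) = b"
        using query_perm_query_perm[OF wf regs, of b] b r by simp
      ultimately show False using False len *(3) by (auto simp: b_def)
    qed
    with False show ?thesis using simulatesD[OF sim *(2-4)] *(1) by auto
  qed
  also have "\<psi> (?q mid) = apply_query (\<lambda>x. F (z @ x)) xs ys \<psi> mid"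
    using regs len by (simp add: apply_query_eq)
  finally show "fold apply_local (query_ops (length z) w C xs ys) \<phi> (z' @ mid @ anc) =
    (if z' = z \<and> anc = replicate r False then apply_query (\<lambda>x. F (z @ x)) xs ys \<psi> mid else 0)"
    by (simp add: b_def)
qed

lemma apply_query_cong:
  assumes "\<And>b. query_basis f xs ys b = query_basis g xs' ys' b"
  shows "apply_query f xs ys = apply_query g xs' ys'"
  using assms by (simp add: apply_query_def fun_eq_iff)

text \<open>Reconciles the fixed format of the classical circuit with that of one \<open>f\<close>:
  surplus argument qubits are ignored and surplus target qubits receive zeros.\<close>

lemma apply_query_padded:
  assumes "\<And>x. length x = length xs \<Longrightarrow> F x = f (take m x) @ replicate l False"
    and "\<And>x. length x = length xs \<Longrightarrow> length (f (take m x)) = k"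
  shows "apply_query F xs ys = apply_query f (take m xs) (take k ys)"
proof (intro apply_query_cong)
  fix b
  show "query_basis F xs ys b = query_basis f (take m xs) (take k ys) b"
    using assms[of "map ((!) b) xs"]
    by (simp add: query_basis_eq xor_into_append_replicate_False take_map)
qed

lemma simulates_operations:
  assumes "simulates z w r \<phi> \<psi>" and "r = length (bool_gates C)"
    and "classical_computes (length z + M) F C" and "\<forall>g \<in> set ops. wf_op M K w g"
    and "\<And>x. length x = M \<Longrightarrow> F (z @ x) = f (take m x) @ replicate l False"
    and "\<And>x. length x = M \<Longrightarrow> length (f (take m x)) = k"
  shows "simulates z w r
    (fold apply_local (concat (map (simulate_op (length z) w C) ops)) \<phi>)
    (fold (apply_op m k f) ops \<psi>)"
  using assms(1,4)
proof (induction ops arbitrary: \<phi> \<psi>)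
  case (Cons g ops)
  have "simulates z w r (fold apply_local (simulate_op (length z) w C g) \<phi>) (apply_op m k f g \<psi>)"
  proof (cases g)
    case (Aux h)
    then show ?thesis using Cons.prems by (simp add: simulates_shift_gate)
  next
    case (Query xs ys)
    then have "apply_query (\<lambda>x. F (z @ x)) xs ys = apply_query f (take m xs) (take k ys)"
      using assms(5,6) Cons.prems(2) by (intro apply_query_padded) auto
    then show ?thesis
      using Query simulates_query_ops[of z w r \<phi> \<psi> C xs F ys] assms(2,3) Cons.prems by simp
  qed
  with Cons show ?case by simp
qed simp

text \<open>Only basis states \<open>z, mid, 0...0\<close> carry amplitude; they correspond
  bijectively to \<open>mid\<close>, and the measured bits lie in \<open>mid\<close>.\<close>

lemma outcome_prob_simulates:
  assumes "simulates z w r \<phi> \<psi>" "set qs \<subseteq> {..<w}"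
  shows "outcome_prob (length z + w + r) (map ((+) (length z)) qs) \<phi> v = outcome_prob w qs \<psi> v"
proof -
  let ?e = "\<lambda>mid. z @ mid @ replicate r False"
  let ?A = "{b. b \<in> bits w \<and> map ((!) b) qs = v}"
  let ?B = "{b. b \<in> bits (length z + w + r) \<and> map ((!) b) (map ((+) (length z)) qs) = v}"
  have nth: "map ((!) (?e mid)) (map ((+) (length z)) qs) = map ((!) mid) qs" if "mid \<in> bits w" for mid
    using that assms(2) by (auto simp: bits_def nth_append)
  have "finite (bits (length z + w + r))"
    unfolding bits_def using finite_lists_length_eq[of "UNIV :: bool set"] by simp
  then have fin: "finite ?B" by (rule rev_finite_subset) auto
  have "(\<Sum>b\<in>?B. (cmod (\<phi> b))\<^sup>2) = (\<Sum>b\<in>?e ` ?A. (cmod (\<phi> b))\<^sup>2)"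
  proof (rule sum.mono_neutral_right[OF fin])
    show "?e ` ?A \<subseteq> ?B"
      using nth by (auto simp: bits_def simp del: map_map)
    show "\<forall>b\<in>?B - ?e ` ?A. (cmod (\<phi> b))\<^sup>2 = 0"
    proof
      fix b assume b: "b \<in> ?B - ?e ` ?A"
      define z' mid anc where "z' = take (length z) b" "mid = take w (drop (length z) b)"
        "anc = drop w (drop (length z) b)"
      have *: "b = z' @ mid @ anc" "length z' = length z" "length mid = w" "length anc = r"
        using b unfolding z'_mid_anc_def by (simp_all only: append_take_drop_id) (simp_all add: bits_def)
      have "\<not> (z' = z \<and> anc = replicate r False)"
      proof
        assume "z' = z \<and> anc = replicate r False"
        with * have "b = ?e mid" "mid \<in> bits w" by (simp_all add: bits_def)
        with b nth[of mid] show False by auto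
      qed
      with simulatesD[OF assms(1) *(2-4)] show "(cmod (\<phi> b))\<^sup>2 = 0"
        by (simp add: *(1))
    qed
  qed
  also have "\<dots> = (\<Sum>b\<in>?A. (cmod (\<phi> (?e b)))\<^sup>2)"
    by (rule sum.reindex_cong[of ?e]) (auto simp: inj_on_def)
  also have "\<dots> = (\<Sum>b\<in>?A. (cmod (\<psi> b))\<^sup>2)"
    by (rule sum.cong) (auto simp: bits_def simulatesD[OF assms(1)])
  finally show ?thesis by (simp add: outcome_prob_def)
qed

section \<open>Gate count\<close>

lemma length_simulate_op:
  assumes "length (output_wires C) \<le> length (bool_gates C)"
    and "length (bool_gates C) \<le> r"
  shows "length (concat (map (simulate_op n w C) ops)) \<le>
     15 * (r * length (filter is_query ops)) + length (filter (\<lambda>g. \<not> is_query g) ops)"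
proof (induction ops)
  case (Cons g ops)
  show ?case
  proof (cases g)
    case (Query xs ys)
    then show ?thesis using Cons length_query_ops[OF assms(1), of n w xs ys] assms(2)
      by (simp add: algebra_simps)
  qed (use Cons in simp)
qed simp

section \<open>Complexity bounds\<close>

lemma classical_complexity_leD:
  assumes "classical_complexity N F \<le> enat r"
  obtains C where "classical_computes N F C" "length (bool_gates C) \<le> r"
proof -
  \<comment> \<open>A strict bound on an infimum yields a member below it, and
    \<open>< Suc r\<close> is \<open>\<le> r\<close> on naturals.\<close>
  have "classical_complexity N F < enat (Suc r)"
    using assms by (rule order_le_less_trans) simp
  then show thesis
    using that by (auto simp: classical_complexity_def INF_less_iff less_Suc_eq_le)
qed

text \<open>Each output has a gate of its own. This is what keeps copying no more expensive than
  evaluating.\<close>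

lemma length_output_wires:
  assumes "wf_classical_circuit N C"
  shows "length (output_wires C) \<le> length (bool_gates C)"
proof -
  have "length (output_wires C) = card (set (output_wires C))"
    using assms by (simp add: wf_classical_circuit_def distinct_card)
  also have "\<dots> \<le> card {N..<N + length (bool_gates C)}"
    using assms by (intro card_mono) (auto simp: wf_classical_circuit_def)
  finally show ?thesis by simp
qed

lemma le_max_size: "h z \<le> max_size h (length z)"
proof -
  have "finite (bits (length z))"
    unfolding bits_def using finite_lists_length_eq[of "UNIV :: bool set"] by simp
  then show ?thesis unfolding max_size_def by (intro Max_ge) (auto simp: bits_def)
qed

text \<open>The bound at a single input length; its constant does not depend on \<open>n\<close>,
  which gives the asymptotic statement.\<close>

lemma quantum_complexity_le:
  fixes m k :: "bool list \<Rightarrow> nat"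
  assumes f: "\<And>z. f z \<in> bits (m z) \<rightarrow>\<^sub>E bits (k z)"
    and R: "classical_complexity (n + max_size m n) (joint_function m k f n) \<le> enat R"
    and wfQ: "wf_query_circuit (max_size m n) (max_size k n) Q"
    and Q: "\<And>z. z \<in> bits n \<Longrightarrow> query_output_prob Q (m z) (k z) (f z) (G z) \<ge> 1 - \<epsilon>"
  shows "quantum_complexity \<epsilon> n G \<le> enat (15 * (R * num_queries Q) + num_auxiliary Q)"
proof -
  let ?F = "joint_function m k f n" and ?M = "max_size m n" and ?K = "max_size k n"
  obtain C where C: "classical_computes (n + ?M) ?F C" "length (bool_gates C) \<le> R"
    using R by (rule classical_complexity_leD)
  have wfC: "wf_classical_circuit (n + ?M) C"
    using C(1) by (simp add: classical_computes_def)
  define r where "r = length (bool_gates C)"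
  define w where "w = length (constants Q)"
  \<comment> \<open>One circuit for all \<open>z\<close> of length \<open>n\<close>; the same
    \<open>r\<close> ancillas serve every query.\<close>
  define D where "D = \<lparr>constants = constants Q @ replicate r False,
     operations = concat (map (simulate_op n w C) (operations Q)),
     output_qubits = map ((+) n) (output_qubits Q)\<rparr>"
  have ops: "\<forall>g \<in> set (operations Q). wf_op ?M ?K w g"
    and out: "distinct (output_qubits Q)" "set (output_qubits Q) \<subseteq> {..<w}"
    using wfQ by (simp_all add: wf_query_circuit_def w_def Let_def)
  have "wf_local_gate (n + w + r) h"
    if g: "g \<in> set (operations Q)" and h: "h \<in> set (simulate_op n w C g)" for g h
  proof (cases g)
    case (Aux a)
    then show ?thesis using ops g h by (auto intro!: wf_shift_gate[of w])
  next
    case (Query xs ys)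
    then have "length xs = ?M" "distinct (xs @ ys)" "set (xs @ ys) \<subseteq> {..<w}"
      using bspec[OF ops g] by simp_all
    then have "implements (n + w + r) (query_ops n w C xs ys) (query_perm n w C xs ys)"
      unfolding r_def using wfC by (intro implements_query_ops) simp_all
    then show ?thesis using h Query by (simp add: implements_def)
  qed
  then have "wf_quantum_circuit n D"
    using out by (auto simp: wf_quantum_circuit_def D_def w_def[symmetric] Let_def distinct_map add.assoc)
  moreover have "output_prob D z (G z) \<ge> 1 - \<epsilon>" if z: "z \<in> bits n" for z
  proof -
    have n: "n = length z" using z by (simp add: bits_def)
    have m: "m z \<le> ?M" "k z \<le> ?K" unfolding n by (rule le_max_size)+
    have "simulates z w r
      (fold apply_local (concat (map (simulate_op (length z) w C) (operations Q)))
         (ket (z @ constants Q @ replicate r False)))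
      (fold (apply_op (m z) (k z) (f z)) (operations Q) (ket (constants Q)))"
    proof (rule simulates_operations[OF _ r_def _ ops])
      show "simulates z w r (ket (z @ constants Q @ replicate r False)) (ket (constants Q))"
        by (rule simulates_ket) (simp add: w_def)
      show "classical_computes (length z + ?M) ?F C" using C(1) n by simp
      show "?F (z @ x) = f z (take (m z) x) @ replicate (?K - k z) False" for x
        by (simp add: joint_function_def n Let_def)
      show "length (f z (take (m z) x)) = k z" if "length x = ?M" for x
      proof -
        \<comment> \<open>Here \<open>m z \<le> ?M\<close> matters: the register is long enough for
          \<open>take\<close> to return exactly \<open>m z\<close> bits.\<close>
        have "take (m z) x \<in> bits (m z)" using that m by (simp add: bits_def)
        then have "f z (take (m z) x) \<in> bits (k z)" using f[of z] by (rule PiE_mem[rotated])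
        then show ?thesis by (simp add: bits_def)
      qed
    qed
    then have "output_prob D z (G z) = query_output_prob Q (m z) (k z) (f z) (G z)"
      using outcome_prob_simulates[OF _ out(2)]
      by (simp add: output_prob_def query_output_prob_def D_def n add.assoc flip: w_def)
    with Q[OF z] show ?thesis by simp
  qed
  ultimately have "quantum_complexity \<epsilon> n G \<le> enat (length (operations D))"
    unfolding quantum_complexity_def by (intro INF_lower) (simp add: quantum_computes_def)
  also have "length (operations D) \<le> 15 * (R * num_queries Q) + num_auxiliary Q"
    using length_simulate_op[OF length_output_wires[OF wfC] C(2)]
    by (simp add: D_def num_queries_def num_auxiliary_def)
  finally show ?thesis by simp
qed

theorem theorem5:
  fixes m k :: "bool list \<Rightarrow> nat"
    and f :: "bool list \<Rightarrow> bool list \<Rightarrow> bool list"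
    and P :: "nat \<Rightarrow> nat \<Rightarrow> (bool list \<Rightarrow> bool list) \<Rightarrow> bool list"
    and R S T :: "nat \<Rightarrow> nat"
    and \<epsilon> :: real
  assumes "\<And>z. f z \<in> bits (m z) \<rightarrow>\<^sub>E bits (k z)"
    and "\<And>n. n > 0 \<Longrightarrow>
           classical_complexity (n + max_size m n) (joint_function m k f n) \<le> enat (R n)"
    and "\<And>n. n > 0 \<Longrightarrow>
           \<exists>C. wf_query_circuit (max_size m n) (max_size k n) C \<and>
               num_queries C \<le> S n \<and> num_auxiliary C \<le> T n \<and>
               (\<forall>z \<in> bits n.
                  query_output_prob C (m z) (k z) (f z) (P (m z) (k z) (f z)) \<ge> 1 - \<epsilon>)"
  shows "\<exists>g :: nat \<Rightarrow> nat.
           (\<forall>n > 0. quantum_complexity \<epsilon> n (\<lambda>z. P (m z) (k z) (f z)) = enat (g n)) \<and>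
           (\<lambda>n. real (g n)) \<in> O(\<lambda>n. real (R n * S n + T n))"
proof -
  let ?q = "\<lambda>n. quantum_complexity \<epsilon> n (\<lambda>z. P (m z) (k z) (f z))"
  \<comment> \<open>For \<open>n > 0\<close> the bound below rules out infinity, so
    \<open>the_enat\<close> is faithful; \<open>g 0\<close> does not affect the asymptotics.\<close>
  define g where "g n = the_enat (?q n)" for n
  have *: "?q n = enat (g n) \<and> g n \<le> 15 * (R n * S n + T n)" if n: "n > 0" for n
  proof -
    obtain Q where Q: "wf_query_circuit (max_size m n) (max_size k n) Q"
      "num_queries Q \<le> S n" "num_auxiliary Q \<le> T n"
      "\<forall>z \<in> bits n. query_output_prob Q (m z) (k z) (f z) (P (m z) (k z) (f z)) \<ge> 1 - \<epsilon>"
      using assms(3)[OF n] by blast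
    have "?q n \<le> enat (15 * (R n * num_queries Q) + num_auxiliary Q)"
      using assms(1) assms(2)[OF n] Q(1,4) by (intro quantum_complexity_le) auto
    \<comment> \<open>The factor 15 is put on \<open>T n\<close> too, so that one constant serves
      both terms.\<close>
    also have "\<dots> \<le> enat (15 * (R n * S n + T n))"
    proof -
      have "R n * num_queries Q \<le> R n * S n" using Q(2) by simp
      then show ?thesis using Q(3) unfolding enat_ord_simps by (simp add: add_mono)
    qed
    finally show ?thesis by (cases "?q n") (simp_all add: g_def)
  qed
  have "(\<lambda>n. real (g n)) \<in> O(\<lambda>n. real (R n * S n + T n))"
  proof (rule bigoI[where c = 15])
    show "\<forall>\<^sub>F n in at_top. norm (real (g n)) \<le> 15 * norm (real (R n * S n + T n))"
      using eventually_gt_at_top[of "0::nat"]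
    proof eventually_elim
      case (elim n)
      then have "real (g n) \<le> real (15 * (R n * S n + T n))" using * of_nat_le_iff by blast
      then show ?case by simp
    qed
  qed
  with * show ?thesis by blast
qed

end
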